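(* Let $C \to B \to A$ be unital ring homomorphisms, regarded as a tower of rings $A\,|\,B\,|\,C$. Then the tower $A\,|\,B\,|\,C$ is right depth three if and only if the natural $A$-$C$-bimodules $A\otimes_B A$ and $A$ are H-equivalent.
   Context: Rings have identity and ring homomorphisms preserve it. A tower of rings $A\,|\,B\,|\,C$ means ring homomorphisms $C\to B\to A$; all bimodule structures are the induced ones. The tower is right depth three (rD3) if there is a positive integer $N$ such that the $A$-$C$-bimodule $A\otimes_B A$ is isomorphic to a direct summand of $A^N$ (direct sum of $N$ copies of the natural $A$-$C$-bimodule $A$). Two modules (or bimodules) $M,N$ are H-equivalent if $M$ is isomorphic to a direct summand of $N^n$ and $N$ is isomorphic to a direct summand of $M^m$ for some positive integers $n,m$. *)

theory Defs
  imports
    "HOL-Algebra.Module"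
    "HOL-Algebra.AbelCoset"
    "HOL-Algebra.Generated_Groups"
    "HOL-Algebra.Free_Abelian_Groups"
begin

section \<open>Bimodules\<close>

text \<open>
  The library's record \<^term>\<open>smult\<close> supplies the left action; its locale \<^locale>\<open>module\<close> is
  limited to commutative rings, so the axioms are stated afresh.  As for library modules, the
  inherited multiplicative components \<^term>\<open>monoid.mult\<close> and \<^term>\<open>monoid.one\<close> are never used.
\<close>

record ('r, 's, 'm) bimodule = "('r, 'm) module" +
  rsmult :: "['m, 's] \<Rightarrow> 'm" (infixl \<open>\<triangleleft>\<index>\<close> 70)

locale bimodule = R: ring R + S: ring S + M: abelian_group M
  for R (structure) and S (structure) and M (structure) +
  assumes smult_closed:
      "\<lbrakk>r \<in> carrier R; x \<in> carrier M\<rbrakk> \<Longrightarrow> r \<odot>\<^bsub>M\<^esub> x \<in> carrier M"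
    and smult_l_distr:
      "\<lbrakk>r \<in> carrier R; r' \<in> carrier R; x \<in> carrier M\<rbrakk> \<Longrightarrow>
        (r \<oplus>\<^bsub>R\<^esub> r') \<odot>\<^bsub>M\<^esub> x = r \<odot>\<^bsub>M\<^esub> x \<oplus>\<^bsub>M\<^esub> r' \<odot>\<^bsub>M\<^esub> x"
    and smult_r_distr:
      "\<lbrakk>r \<in> carrier R; x \<in> carrier M; y \<in> carrier M\<rbrakk> \<Longrightarrow>
        r \<odot>\<^bsub>M\<^esub> (x \<oplus>\<^bsub>M\<^esub> y) = r \<odot>\<^bsub>M\<^esub> x \<oplus>\<^bsub>M\<^esub> r \<odot>\<^bsub>M\<^esub> y"
    and smult_assoc:
      "\<lbrakk>r \<in> carrier R; r' \<in> carrier R; x \<in> carrier M\<rbrakk> \<Longrightarrow>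
        (r \<otimes>\<^bsub>R\<^esub> r') \<odot>\<^bsub>M\<^esub> x = r \<odot>\<^bsub>M\<^esub> (r' \<odot>\<^bsub>M\<^esub> x)"
    and smult_one: "x \<in> carrier M \<Longrightarrow> \<one>\<^bsub>R\<^esub> \<odot>\<^bsub>M\<^esub> x = x"
    and rsmult_closed:
      "\<lbrakk>s \<in> carrier S; x \<in> carrier M\<rbrakk> \<Longrightarrow> x \<triangleleft>\<^bsub>M\<^esub> s \<in> carrier M"
    and rsmult_r_distr:
      "\<lbrakk>s \<in> carrier S; s' \<in> carrier S; x \<in> carrier M\<rbrakk> \<Longrightarrow>
        x \<triangleleft>\<^bsub>M\<^esub> (s \<oplus>\<^bsub>S\<^esub> s') = x \<triangleleft>\<^bsub>M\<^esub> s \<oplus>\<^bsub>M\<^esub> x \<triangleleft>\<^bsub>M\<^esub> s'"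
    and rsmult_l_distr:
      "\<lbrakk>s \<in> carrier S; x \<in> carrier M; y \<in> carrier M\<rbrakk> \<Longrightarrow>
        (x \<oplus>\<^bsub>M\<^esub> y) \<triangleleft>\<^bsub>M\<^esub> s = x \<triangleleft>\<^bsub>M\<^esub> s \<oplus>\<^bsub>M\<^esub> y \<triangleleft>\<^bsub>M\<^esub> s"
    and rsmult_assoc:
      "\<lbrakk>s \<in> carrier S; s' \<in> carrier S; x \<in> carrier M\<rbrakk> \<Longrightarrow>
        x \<triangleleft>\<^bsub>M\<^esub> (s \<otimes>\<^bsub>S\<^esub> s') = (x \<triangleleft>\<^bsub>M\<^esub> s) \<triangleleft>\<^bsub>M\<^esub> s'"
    and rsmult_one: "x \<in> carrier M \<Longrightarrow> x \<triangleleft>\<^bsub>M\<^esub> \<one>\<^bsub>S\<^esub> = x"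
    and smult_rsmult:
      "\<lbrakk>r \<in> carrier R; s \<in> carrier S; x \<in> carrier M\<rbrakk> \<Longrightarrow>
        (r \<odot>\<^bsub>M\<^esub> x) \<triangleleft>\<^bsub>M\<^esub> s = r \<odot>\<^bsub>M\<^esub> (x \<triangleleft>\<^bsub>M\<^esub> s)"

definition bimodule_iso ::
  "('r, 'a) ring_scheme \<Rightarrow> ('s, 'b) ring_scheme \<Rightarrow>
   ('r, 's, 'm, 'c) bimodule_scheme \<Rightarrow> ('r, 's, 'n, 'd) bimodule_scheme \<Rightarrow> ('m \<Rightarrow> 'n) set" where
  "bimodule_iso R S M N =
    {h. bij_betw h (carrier M) (carrier N) \<and>
        (\<forall>x\<in>carrier M. \<forall>y\<in>carrier M. h (x \<oplus>\<^bsub>M\<^esub> y) = h x \<oplus>\<^bsub>N\<^esub> h y) \<and>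
        (\<forall>r\<in>carrier R. \<forall>x\<in>carrier M. h (r \<odot>\<^bsub>M\<^esub> x) = r \<odot>\<^bsub>N\<^esub> h x) \<and>
        (\<forall>s\<in>carrier S. \<forall>x\<in>carrier M. h (x \<triangleleft>\<^bsub>M\<^esub> s) = h x \<triangleleft>\<^bsub>N\<^esub> s)}"

definition subbimodule ::
  "('r, 'a) ring_scheme \<Rightarrow> ('s, 'b) ring_scheme \<Rightarrow> 'm set \<Rightarrow>
   ('r, 's, 'm, 'c) bimodule_scheme \<Rightarrow> bool" where
  "subbimodule R S K M \<longleftrightarrow>
    additive_subgroup K M \<and>
    (\<forall>r\<in>carrier R. \<forall>x\<in>K. r \<odot>\<^bsub>M\<^esub> x \<in> K) \<and>
    (\<forall>s\<in>carrier S. \<forall>x\<in>K. x \<triangleleft>\<^bsub>M\<^esub> s \<in> K)"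

definition direct_summand ::
  "('r, 'a) ring_scheme \<Rightarrow> ('s, 'b) ring_scheme \<Rightarrow> 'm set \<Rightarrow>
   ('r, 's, 'm, 'c) bimodule_scheme \<Rightarrow> bool" where
  "direct_summand R S K M \<longleftrightarrow>
    subbimodule R S K M \<and>
    (\<exists>L. subbimodule R S L M \<and> K <+>\<^bsub>M\<^esub> L = carrier M \<and> K \<inter> L = {\<zero>\<^bsub>M\<^esub>})"

definition iso_direct_summand ::
  "('r, 'a) ring_scheme \<Rightarrow> ('s, 'b) ring_scheme \<Rightarrow>
   ('r, 's, 'm, 'c) bimodule_scheme \<Rightarrow> ('r, 's, 'n, 'd) bimodule_scheme \<Rightarrow> bool" where
  "iso_direct_summand R S M N \<longleftrightarrow>
    (\<exists>K. direct_summand R S K N \<and> bimodule_iso R S M (N\<lparr>carrier := K\<rparr>) \<noteq> {})"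

definition bimodule_power ::
  "('r, 's, 'm, 'c) bimodule_scheme \<Rightarrow> nat \<Rightarrow> ('r, 's, nat \<Rightarrow> 'm) bimodule" where
  "bimodule_power M n =
    \<lparr>carrier = (\<Pi>\<^sub>E i\<in>{..<n}. carrier M), monoid.mult = undefined, one = undefined,
     ring.zero = (\<lambda>i\<in>{..<n}. \<zero>\<^bsub>M\<^esub>),
     ring.add = (\<lambda>x y. \<lambda>i\<in>{..<n}. x i \<oplus>\<^bsub>M\<^esub> y i),
     smult = (\<lambda>r x. \<lambda>i\<in>{..<n}. r \<odot>\<^bsub>M\<^esub> x i),
     rsmult = (\<lambda>x s. \<lambda>i\<in>{..<n}. x i \<triangleleft>\<^bsub>M\<^esub> s)\<rparr>"

definition H_equivalent ::
  "('r, 'a) ring_scheme \<Rightarrow> ('s, 'b) ring_scheme \<Rightarrow>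
   ('r, 's, 'm, 'c) bimodule_scheme \<Rightarrow> ('r, 's, 'n, 'd) bimodule_scheme \<Rightarrow> bool" where
  "H_equivalent R S M N \<longleftrightarrow>
    (\<exists>n>0. iso_direct_summand R S M (bimodule_power N n)) \<and>
    (\<exists>m>0. iso_direct_summand R S N (bimodule_power M m))"


section \<open>Tensor products\<close>

text \<open>
  The tensor product over \<open>B\<close> of a right \<open>B\<close>-module \<open>M\<close> and a left \<open>B\<close>-module \<open>N\<close> is the free
  abelian group on pairs, modulo the subgroup generated by the additivity and balancing
  relations.
\<close>

abbreviation tensor_free ::
  "('r, 'b, 'm, 'c) bimodule_scheme \<Rightarrow> ('b, 's, 'n, 'd) bimodule_scheme \<Rightarrow>
   (('m \<times> 'n) \<Rightarrow>\<^sub>0 int) monoid" where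
  "tensor_free M N \<equiv> free_Abelian_group (carrier M \<times> carrier N)"

definition tensor_relators ::
  "('b, 'a) ring_scheme \<Rightarrow> ('r, 'b, 'm, 'c) bimodule_scheme \<Rightarrow>
   ('b, 's, 'n, 'd) bimodule_scheme \<Rightarrow> (('m \<times> 'n) \<Rightarrow>\<^sub>0 int) set" where
  "tensor_relators B M N =
    {frag_of (x \<oplus>\<^bsub>M\<^esub> x', y) - frag_of (x, y) - frag_of (x', y) | x x' y.
      x \<in> carrier M \<and> x' \<in> carrier M \<and> y \<in> carrier N} \<union>
    {frag_of (x, y \<oplus>\<^bsub>N\<^esub> y') - frag_of (x, y) - frag_of (x, y') | x y y'.
      x \<in> carrier M \<and> y \<in> carrier N \<and> y' \<in> carrier N} \<union>
    {frag_of (x \<triangleleft>\<^bsub>M\<^esub> b, y) - frag_of (x, b \<odot>\<^bsub>N\<^esub> y) | x b y.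
      x \<in> carrier M \<and> b \<in> carrier B \<and> y \<in> carrier N}"

definition tensor_kernel ::
  "('b, 'a) ring_scheme \<Rightarrow> ('r, 'b, 'm, 'c) bimodule_scheme \<Rightarrow>
   ('b, 's, 'n, 'd) bimodule_scheme \<Rightarrow> (('m \<times> 'n) \<Rightarrow>\<^sub>0 int) set" where
  "tensor_kernel B M N = generate (tensor_free M N) (tensor_relators B M N)"

text \<open>
  A self-map \<open>p\<close> of the generators acts on a coset \<open>X\<close> by applying the linear extension of \<open>p\<close>
  elementwise and saturating the image to a full coset of the kernel.
\<close>

definition tensor_induced ::
  "('b, 'a) ring_scheme \<Rightarrow> ('r, 'b, 'm, 'c) bimodule_scheme \<Rightarrow>
   ('b, 's, 'n, 'd) bimodule_scheme \<Rightarrow> ('m \<times> 'n \<Rightarrow> 'm \<times> 'n) \<Rightarrow>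
   (('m \<times> 'n) \<Rightarrow>\<^sub>0 int) set \<Rightarrow> (('m \<times> 'n) \<Rightarrow>\<^sub>0 int) set" where
  "tensor_induced B M N p X =
    tensor_kernel B M N <#>\<^bsub>tensor_free M N\<^esub> (frag_extend (frag_of \<circ> p) ` X)"

definition tensor_product ::
  "('b, 'a) ring_scheme \<Rightarrow> ('r, 'b, 'm, 'c) bimodule_scheme \<Rightarrow>
   ('b, 's, 'n, 'd) bimodule_scheme \<Rightarrow> ('r, 's, (('m \<times> 'n) \<Rightarrow>\<^sub>0 int) set) bimodule" where
  "tensor_product B M N = (let Q = tensor_free M N Mod tensor_kernel B M N in
    \<lparr>carrier = carrier Q, monoid.mult = undefined, one = undefined,
     ring.zero = \<one>\<^bsub>Q\<^esub>, ring.add = monoid.mult Q,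
     smult = (\<lambda>r. tensor_induced B M N (\<lambda>(x, y). (r \<odot>\<^bsub>M\<^esub> x, y))),
     rsmult = (\<lambda>X s. tensor_induced B M N (\<lambda>(x, y). (x, y \<triangleleft>\<^bsub>N\<^esub> s)) X)\<rparr>)"


section \<open>Towers of rings\<close>

definition induced_bimodule ::
  "('a, 'c) ring_scheme \<Rightarrow> ('r \<Rightarrow> 'a) \<Rightarrow> ('s \<Rightarrow> 'a) \<Rightarrow> ('r, 's, 'a) bimodule" where
  "induced_bimodule A \<phi> \<psi> =
    \<lparr>carrier = carrier A, monoid.mult = undefined, one = undefined,
     ring.zero = \<zero>\<^bsub>A\<^esub>, ring.add = ring.add A,
     smult = (\<lambda>r x. \<phi> r \<otimes>\<^bsub>A\<^esub> x), rsmult = (\<lambda>x s. x \<otimes>\<^bsub>A\<^esub> \<psi> s)\<rparr>"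

text \<open>
  In what follows the tower is given by \<open>f : C \<rightarrow> B\<close> and \<open>g : B \<rightarrow> A\<close>.
\<close>

definition tower_regular ::
  "('a, 'k) ring_scheme \<Rightarrow> ('c \<Rightarrow> 'b) \<Rightarrow> ('b \<Rightarrow> 'a) \<Rightarrow> ('a, 'c, 'a) bimodule" where
  "tower_regular A f g = induced_bimodule A id (g \<circ> f)"

definition tower_tensor ::
  "('a, 'k) ring_scheme \<Rightarrow> ('b, 'l) ring_scheme \<Rightarrow> ('c \<Rightarrow> 'b) \<Rightarrow> ('b \<Rightarrow> 'a) \<Rightarrow>
   ('a, 'c, (('a \<times> 'a) \<Rightarrow>\<^sub>0 int) set) bimodule" where
  "tower_tensor A B f g =
    tensor_product B (induced_bimodule A id g) (induced_bimodule A g (g \<circ> f))"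

definition right_depth_three ::
  "('a, 'k) ring_scheme \<Rightarrow> ('b, 'l) ring_scheme \<Rightarrow> ('c, 'm) ring_scheme \<Rightarrow>
   ('c \<Rightarrow> 'b) \<Rightarrow> ('b \<Rightarrow> 'a) \<Rightarrow> bool" where
  "right_depth_three A B C f g \<longleftrightarrow>
    (\<exists>N>0. iso_direct_summand A C (tower_tensor A B f g)
             (bimodule_power (tower_regular A f g) N))"


section \<open>The constructions yield bimodules\<close>

lemma induced_bimodule_bimodule:
  assumes "ring A" "ring R" "ring S" "\<phi> \<in> ring_hom R A" "\<psi> \<in> ring_hom S A"
  shows "bimodule R S (induced_bimodule A \<phi> \<psi>)"
proof -
  interpret A: ring A by fact
  interpret R: ring R by fact
  interpret S: ring S by fact
  have ab: "abelian_group (induced_bimodule A \<phi> \<psi>)"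
    by (rule abelian_groupI)
      (auto simp: induced_bimodule_def A.a_ac intro: A.a_inv_closed A.l_neg)
  note h = assms(4,5)[THEN ring_hom_closed] assms(4,5)[THEN ring_hom_mult]
    assms(4,5)[THEN ring_hom_add] assms(4,5)[THEN ring_hom_one]
  show ?thesis
    by (intro bimodule.intro bimodule_axioms.intro assms ab)
      (auto simp: induced_bimodule_def h A.l_distr A.r_distr A.m_assoc)
qed

lemma bimodule_power_bimodule:
  assumes "bimodule R S M"
  shows "bimodule R S (bimodule_power M n)"
proof -
  interpret bimodule R S M by fact
  have ab: "abelian_group (bimodule_power M n)"
  proof (rule abelian_groupI, goal_cases)
    case (6 x)
    then have "(\<lambda>i\<in>{..<n}. \<ominus>\<^bsub>M\<^esub> x i) \<in> carrier (bimodule_power M n)"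
      "(\<lambda>i\<in>{..<n}. \<ominus>\<^bsub>M\<^esub> x i) \<oplus>\<^bsub>bimodule_power M n\<^esub> x = \<zero>\<^bsub>bimodule_power M n\<^esub>"
      by (auto simp: bimodule_power_def PiE_iff M.l_neg intro!: restrict_ext)
    then show ?case by blast
  qed (auto simp: bimodule_power_def PiE_iff M.a_ac extensional_def fun_eq_iff restrict_def)
  show ?thesis
    by (intro bimodule.intro bimodule_axioms.intro R.ring_axioms S.ring_axioms ab)
      (auto simp: bimodule_power_def PiE_iff smult_closed smult_l_distr smult_r_distr smult_assoc
        smult_one rsmult_closed rsmult_l_distr rsmult_r_distr rsmult_assoc rsmult_one smult_rsmult
        extensional_def fun_eq_iff restrict_def)
qed

lemma tensor_relators_carrier:
  assumes "bimodule R B M" "bimodule B S N"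
  shows "tensor_relators B M N \<subseteq> carrier (tensor_free M N)"
proof -
  interpret M: bimodule R B M by fact
  interpret N: bimodule B S N by fact
  have d: "u - v \<in> carrier (tensor_free M N)"
    if "u \<in> carrier (tensor_free M N)" "v \<in> carrier (tensor_free M N)" for u v
    using that keys_diff[of u v] by (auto simp: free_Abelian_group_def)
  show ?thesis
    unfolding tensor_relators_def
    by (auto intro!: d simp: M.rsmult_closed N.smult_closed simp del: carrier_free_Abelian_group_iff)
qed

lemma tensor_kernel_subgroup:
  assumes "bimodule R B M" "bimodule B S N"
  shows "subgroup (tensor_kernel B M N) (tensor_free M N)"
  unfolding tensor_kernel_def
  by (rule group.generate_is_subgroup[OF group_free_Abelian_group tensor_relators_carrier[OF assms]])

lemma frag_hom_closed:
  assumes "p \<in> carrier M \<times> carrier N \<rightarrow> carrier M \<times> carrier N" "x \<in> carrier (tensor_free M N)"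
  shows "frag_extend (frag_of \<circ> p) x \<in> carrier (tensor_free M N)"
proof -
  have "Poly_Mapping.keys ((frag_of \<circ> p) z) \<subseteq> carrier M \<times> carrier N" if "z \<in> Poly_Mapping.keys x" for z
  proof -
    have "z \<in> carrier M \<times> carrier N" using that assms(2) by auto
    then have "p z \<in> carrier M \<times> carrier N" using assms(1) by blast
    then show ?thesis by simp
  qed
  then show ?thesis
    using keys_frag_extend[of "frag_of \<circ> p" x] unfolding carrier_free_Abelian_group_iff by blast
qed

lemma kernel_stable:
  assumes bm: "bimodule R B M" "bimodule B S N"
    and st: "\<And>t. t \<in> tensor_relators B M N \<Longrightarrow> frag_extend (frag_of \<circ> p) t \<in> tensor_kernel B M N"
    and k: "k \<in> tensor_kernel B M N"
  shows "frag_extend (frag_of \<circ> p) k \<in> tensor_kernel B M N"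
  using k unfolding tensor_kernel_def
proof (induction rule: generate.induct)
  case one
  then show ?case by simp (metis generate.one one_free_Abelian_group)
next
  case (incl h) then show ?case using st tensor_kernel_def by metis
next
  case (inv h)
  interpret K: subgroup "tensor_kernel B M N" "tensor_free M N" by (rule tensor_kernel_subgroup[OF bm])
  have "h \<in> carrier (tensor_free M N)" using tensor_relators_carrier[OF bm] inv by blast
  then have "inv\<^bsub>tensor_free M N\<^esub> h = -h" by simp
  moreover have "inv\<^bsub>tensor_free M N\<^esub> (frag_extend (frag_of \<circ> p) h) = - frag_extend (frag_of \<circ> p) h"
    using st[OF inv] K.subset by (auto)
  ultimately show ?case using K.m_inv_closed[OF st[OF inv]]
    by (simp only: frag_extend_minus tensor_kernel_def)
next
  case (eng h1 h2)
  then show ?case by (simp add: frag_extend_add) (metis generate.eng mult_free_Abelian_group)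
qed

lemma tensor_induced_coset:
  assumes bm: "bimodule R B M" "bimodule B S N"
    and p: "p \<in> carrier M \<times> carrier N \<rightarrow> carrier M \<times> carrier N"
    and st: "\<And>t. t \<in> tensor_relators B M N \<Longrightarrow> frag_extend (frag_of \<circ> p) t \<in> tensor_kernel B M N"
    and x: "x \<in> carrier (tensor_free M N)"
  shows "tensor_induced B M N p (tensor_kernel B M N #>\<^bsub>tensor_free M N\<^esub> x) =
    tensor_kernel B M N #>\<^bsub>tensor_free M N\<^esub> frag_extend (frag_of \<circ> p) x"
proof -
  interpret K: subgroup "tensor_kernel B M N" "tensor_free M N" by (rule tensor_kernel_subgroup[OF bm])
  note ks = kernel_stable[OF bm st]
  have z: "0 \<in> tensor_kernel B M N" using K.one_closed by simp
  have a: "u + v \<in> tensor_kernel B M N" if "u \<in> tensor_kernel B M N" "v \<in> tensor_kernel B M N" for u v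
    using K.m_closed[OF that] by simp
  let ?K = "tensor_kernel B M N" and ?h = "frag_extend (frag_of \<circ> p)"
  have "tensor_induced B M N p (?K #>\<^bsub>tensor_free M N\<^esub> x) = {u + ?h (k + x) | u k. u \<in> ?K \<and> k \<in> ?K}"
    unfolding tensor_induced_def set_mult_def r_coset_def by (auto simp del: o_apply)
  also have "\<dots> = {u + (?h k + ?h x) | u k. u \<in> ?K \<and> k \<in> ?K}"
    by (simp only: frag_extend_add)
  also have "\<dots> = {v + ?h x | v. v \<in> ?K}"
  proof (intro equalityI subsetI; clarify)
    fix u k assume "u \<in> ?K" "k \<in> ?K"
    then have "u + ?h k \<in> ?K" using a ks by blast
    then show "\<exists>v. u + (?h k + ?h x) = v + ?h x \<and> v \<in> ?K"
      by (intro exI[of _ "u + ?h k"]) (simp only: add.assoc)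
  next
    fix v assume "v \<in> ?K"
    then show "\<exists>u k. v + ?h x = u + (?h k + ?h x) \<and> u \<in> ?K \<and> k \<in> ?K"
      using z by (intro exI[of _ v] exI[of _ 0]) simp
  qed
  also have "\<dots> = ?K #>\<^bsub>tensor_free M N\<^esub> ?h x"
    unfolding r_coset_def by (auto simp del: o_apply)
  finally show ?thesis .
qed

lemma tensor_product_bimodule:
  fixes M :: "('r, 'b, 'd, 'm) bimodule_scheme" and N :: "('b, 's, 'f, 'n) bimodule_scheme"
  assumes bm: "bimodule R B M" "bimodule B S N"
  shows "bimodule R S (tensor_product B M N)"
proof -
  interpret M: bimodule R B M by fact
  interpret N: bimodule B S N by fact
  let ?F = "tensor_free M N" and ?K = "tensor_kernel B M N" and ?T = "tensor_product B M N"
  interpret F: comm_group ?F by (rule abelian_free_Abelian_group)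
  interpret K: subgroup ?K ?F by (rule tensor_kernel_subgroup[OF bm])
  interpret K: normal ?K ?F by (rule F.subgroup_imp_normal[OF tensor_kernel_subgroup[OF bm]])
  interpret Q: comm_group "?F Mod ?K" by (rule F.abelian_FactGroup[OF tensor_kernel_subgroup[OF bm]])
  define L where "L r = (\<lambda>(x, y). (r \<odot>\<^bsub>M\<^esub> x, y :: 'f))" for r
  define P where "P s = (\<lambda>(x :: 'd, y). (x, y \<triangleleft>\<^bsub>N\<^esub> s))" for s
  let ?c = "\<lambda>x. ?K #>\<^bsub>?F\<^esub> x"
  let ?e = "\<lambda>p. frag_extend (frag_of \<circ> p)"
  have K0: "0 \<in> ?K" using K.one_closed by simp
  have Kadd: "u + v \<in> ?K" if "u \<in> ?K" "v \<in> ?K" for u v using K.m_closed[OF that] by simp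
  have Kdiff: "u - v \<in> ?K" if "u \<in> ?K" "v \<in> ?K" for u v
  proof -
    have "v \<in> carrier ?F" using K.subset that by blast
    then have "inv\<^bsub>?F\<^esub> v = - v" by simp
    then show ?thesis using Kadd[OF that(1) K.m_inv_closed[OF that(2)]] by simp
  qed
  have rel: "t \<in> tensor_relators B M N \<Longrightarrow> t \<in> ?K" for t
    unfolding tensor_kernel_def by (rule generate.incl)
  have Lc: "L r \<in> carrier M \<times> carrier N \<rightarrow> carrier M \<times> carrier N" if "r \<in> carrier R" for r
    using that by (auto simp: L_def M.smult_closed)
  have Pc: "P s \<in> carrier M \<times> carrier N \<rightarrow> carrier M \<times> carrier N" if "s \<in> carrier S" for s
    using that by (auto simp: P_def N.rsmult_closed)
  have rel1: "frag_of (x \<oplus>\<^bsub>M\<^esub> x', y) - frag_of (x, y) - frag_of (x', y) \<in> ?K"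
    if "x \<in> carrier M" "x' \<in> carrier M" "y \<in> carrier N" for x x' y
    by (rule rel) (use that in \<open>auto simp: tensor_relators_def\<close>)
  have rel2: "frag_of (x, y \<oplus>\<^bsub>N\<^esub> y') - frag_of (x, y) - frag_of (x, y') \<in> ?K"
    if "x \<in> carrier M" "y \<in> carrier N" "y' \<in> carrier N" for x y y'
    by (rule rel) (use that in \<open>auto simp: tensor_relators_def\<close>)
  have rel3: "frag_of (x \<triangleleft>\<^bsub>M\<^esub> b, y) - frag_of (x, b \<odot>\<^bsub>N\<^esub> y) \<in> ?K"
    if "x \<in> carrier M" "b \<in> carrier B" "y \<in> carrier N" for x b y
    by (rule rel) (use that in \<open>auto simp: tensor_relators_def\<close>)
  have Ls: "?e (L r) t \<in> ?K" if "r \<in> carrier R" "t \<in> tensor_relators B M N" for r t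
    using that(2) unfolding tensor_relators_def
    by (safe; simp add: that(1) frag_extend_diff L_def M.smult_r_distr M.smult_rsmult[symmetric]
        rel1 rel2 rel3 M.smult_closed)
  have Ps: "?e (P s) t \<in> ?K" if "s \<in> carrier S" "t \<in> tensor_relators B M N" for s t
    using that(2) unfolding tensor_relators_def
    by (safe; simp add: that(1) frag_extend_diff P_def N.rsmult_l_distr N.smult_rsmult
        rel1 rel2 rel3 N.rsmult_closed)
  have carr: "carrier ?T = ?c ` carrier ?F"
    by (simp add: tensor_product_def Let_def carrier_FactGroup)
  have addT: "?c x \<oplus>\<^bsub>?T\<^esub> ?c y = ?c (x + y)" if "x \<in> carrier ?F" "y \<in> carrier ?F" for x y
    using K.rcos_sum[OF that] by (simp add: tensor_product_def Let_def)
  have LT: "r \<odot>\<^bsub>?T\<^esub> ?c x = ?c (?e (L r) x)" if "r \<in> carrier R" "x \<in> carrier ?F" for r x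
    using tensor_induced_coset[OF bm Lc[OF that(1)] Ls[OF that(1)] that(2)]
    by (simp add: tensor_product_def Let_def L_def)
  have PT: "?c x \<triangleleft>\<^bsub>?T\<^esub> s = ?c (?e (P s) x)" if "s \<in> carrier S" "x \<in> carrier ?F" for s x
    using tensor_induced_coset[OF bm Pc[OF that(1)] Ps[OF that(1)] that(2)]
    by (simp add: tensor_product_def Let_def P_def)
  have eqc: "?c x = ?c y" if "x - y \<in> ?K" "x \<in> carrier ?F" "y \<in> carrier ?F" for x y
  proof -
    have "x = (x - y) \<otimes>\<^bsub>?F\<^esub> y" by simp
    then have "x \<in> ?c y" using that(1) unfolding r_coset_def by blast
    then show ?thesis using F.repr_independence[OF _ that(3) K.subgroup_axioms] by simp
  qed
  have LF: "?e (L r) x \<in> carrier ?F" if "r \<in> carrier R" "x \<in> carrier ?F" for r x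
    by (rule frag_hom_closed[OF Lc[OF that(1)] that(2)])
  have PF: "?e (P s) x \<in> carrier ?F" if "s \<in> carrier S" "x \<in> carrier ?F" for s x
    by (rule frag_hom_closed[OF Pc[OF that(1)] that(2)])
  have Fadd: "u + v \<in> carrier ?F" if "u \<in> carrier ?F" "v \<in> carrier ?F" for u v
    using F.m_closed[OF that] by simp
  have ab: "abelian_group ?T"
  proof -
    have T: "carrier ?T = carrier (?F Mod ?K)" "\<And>X Y. X \<oplus>\<^bsub>?T\<^esub> Y = X \<otimes>\<^bsub>?F Mod ?K\<^esub> Y"
      "\<zero>\<^bsub>?T\<^esub> = \<one>\<^bsub>?F Mod ?K\<^esub>"
      by (simp_all add: tensor_product_def Let_def)
    show ?thesis
    proof (rule abelian_groupI; unfold T)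
    qed (rule Q.m_closed Q.one_closed Q.m_assoc Q.m_comm Q.l_one Q.l_inv_ex; assumption)+
  qed
  have lin: "h x \<in> ?K" if h: "\<And>u v. h (u - v) = h u - h v" "h 0 = 0"
    and g: "\<And>m n. m \<in> carrier M \<Longrightarrow> n \<in> carrier N \<Longrightarrow> h (frag_of (m, n)) \<in> ?K"
    and x: "x \<in> carrier ?F" for h :: "('d \<times> 'f \<Rightarrow>\<^sub>0 int) \<Rightarrow> ('d \<times> 'f \<Rightarrow>\<^sub>0 int)" and x
  proof -
    have "Poly_Mapping.keys x \<subseteq> carrier M \<times> carrier N" using x by simp
    then show ?thesis
      by (induction rule: frag_induction) (auto simp: h K0 g intro: Kdiff)
  qed
  have D1: "?e (L (r \<oplus>\<^bsub>R\<^esub> r')) x - (?e (L r) x + ?e (L r') x) \<in> ?K"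
    if "r \<in> carrier R" "r' \<in> carrier R" "x \<in> carrier ?F" for r r' x
  proof (rule lin[of "\<lambda>x. ?e (L (r \<oplus>\<^bsub>R\<^esub> r')) x - (?e (L r) x + ?e (L r') x)"])
    show "x \<in> carrier ?F" by fact
  qed (use that in \<open>simp_all add: frag_extend_diff L_def M.smult_l_distr diff_diff_eq[symmetric]
        rel1 M.smult_closed\<close>)
  have D2: "?e (P (s \<oplus>\<^bsub>S\<^esub> s')) x - (?e (P s) x + ?e (P s') x) \<in> ?K"
    if "s \<in> carrier S" "s' \<in> carrier S" "x \<in> carrier ?F" for s s' x
  proof (rule lin[of "\<lambda>x. ?e (P (s \<oplus>\<^bsub>S\<^esub> s')) x - (?e (P s) x + ?e (P s') x)"])
    show "x \<in> carrier ?F" by fact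
  qed (use that in \<open>simp_all add: frag_extend_diff P_def N.rsmult_r_distr diff_diff_eq[symmetric]
        rel2 N.rsmult_closed\<close>)
  have E1: "?c (?e (L (r \<oplus>\<^bsub>R\<^esub> r')) x) = ?c (?e (L r) x + ?e (L r') x)"
    if "r \<in> carrier R" "r' \<in> carrier R" "x \<in> carrier ?F" for r r' x
    by (rule eqc[OF D1]) (use that in \<open>simp_all only: LF Fadd M.R.a_closed\<close>)
  have E2: "?c (?e (P (s \<oplus>\<^bsub>S\<^esub> s')) x) = ?c (?e (P s) x + ?e (P s') x)"
    if "s \<in> carrier S" "s' \<in> carrier S" "x \<in> carrier ?F" for s s' x
    by (rule eqc[OF D2]) (use that in \<open>simp_all only: PF Fadd N.S.a_closed\<close>)
  have cong: "?e p x = ?e q x" if "\<And>m n. m \<in> carrier M \<Longrightarrow> n \<in> carrier N \<Longrightarrow> p (m, n) = q (m, n)"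
    "x \<in> carrier ?F" for p q :: "'d \<times> 'f \<Rightarrow> 'd \<times> 'f" and x
    by (rule frag_extend_eq) (use that in auto)
  have comp: "?e p (?e q x) = ?e (p \<circ> q) x" for p q :: "'d \<times> 'f \<Rightarrow> 'd \<times> 'f" and x
    by (simp add: frag_extend_compose comp_assoc)
  have ide: "frag_extend frag_of x = x" for x :: "'d \<times> 'f \<Rightarrow>\<^sub>0 int"
    by (rule frag_expansion[symmetric])
  have C1: "?e (L (r \<otimes>\<^bsub>R\<^esub> r')) x = ?e (L r) (?e (L r') x)"
    if "r \<in> carrier R" "r' \<in> carrier R" "x \<in> carrier ?F" for r r' x
    unfolding comp by (rule cong) (use that in \<open>auto simp: L_def M.smult_assoc\<close>)
  have C2: "?e (P (s \<otimes>\<^bsub>S\<^esub> s')) x = ?e (P s') (?e (P s) x)"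
    if "s \<in> carrier S" "s' \<in> carrier S" "x \<in> carrier ?F" for s s' x
    unfolding comp by (rule cong) (use that in \<open>auto simp: P_def N.rsmult_assoc\<close>)
  have C3: "?e (P s) (?e (L r) x) = ?e (L r) (?e (P s) x)"
    if "x \<in> carrier ?F" for r s x
    unfolding comp by (rule cong) (use that in \<open>auto simp: P_def L_def\<close>)
  note [simp del] = carrier_free_Abelian_group_iff o_apply
  show ?thesis
  proof (intro bimodule.intro bimodule_axioms.intro M.R.ring_axioms N.S.ring_axioms ab, goal_cases)
    case (1 r X) then show ?case by (auto simp: carr LT LF)
  next
    case (2 r r' X) then show ?case by (auto simp: carr LT LF addT E1)
  next
    case (3 r X Y) then show ?case by (auto simp: carr LT LF addT Fadd frag_extend_add)
  next
    case (4 r r' X)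
    then show ?case by (auto simp: carr LT LF C1)
  next
    case (5 X)
    then obtain x where x: "x \<in> carrier ?F" "X = ?c x" by (auto simp: carr)
    have "?e (L \<one>\<^bsub>R\<^esub>) x = ?e id x" by (rule cong[OF _ x(1)]) (simp add: L_def M.smult_one)
    then show ?case using x by (simp add: LT ide)
  next
    case (6 s X) then show ?case by (auto simp: carr PT PF)
  next
    case (7 s s' X) then show ?case by (auto simp: carr PT PF addT E2)
  next
    case (8 s X Y) then show ?case by (auto simp: carr PT PF addT Fadd frag_extend_add)
  next
    case (9 s s' X)
    then show ?case by (auto simp: carr PT PF C2)
  next
    case (10 X)
    then obtain x where x: "x \<in> carrier ?F" "X = ?c x" by (auto simp: carr)
    have "?e (P \<one>\<^bsub>S\<^esub>) x = ?e id x" by (rule cong[OF _ x(1)]) (simp add: P_def N.rsmult_one)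
    then show ?case using x by (simp add: PT ide)
  next
    case (11 r s X)
    then show ?case by (auto simp: carr LT LF PT PF C3)
  qed
qed

end

theory Submission
  imports Defs
begin

text \<open>
  H-equivalence asks for two summand relations: \<open>A \<otimes>\<^sub>B A\<close> in a power of \<open>A\<close>, which is right depth
  three verbatim, and \<open>A\<close> in a power of \<open>A \<otimes>\<^sub>B A\<close>.  The second relation holds for every tower.
  Indeed the map \<open>a \<mapsto> a \<otimes> 1\<close> from \<open>A\<close> to \<open>A \<otimes>\<^sub>B A\<close> is a
  homomorphism of \<open>A\<close>-\<open>C\<close>-bimodules: the image of \<open>C\<close> in \<open>A\<close> factors through \<open>B\<close>, so
  \<open>ac \<otimes> 1 = a \<otimes> c\<close> by balancing.  The multiplication map \<open>a \<otimes> a' \<mapsto> aa'\<close> splits it, and a split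
  monomorphism exhibits its source as a direct summand of its target.  One copy of \<open>A \<otimes>\<^sub>B A\<close>
  is therefore enough.

  The multiplication map comes from the universal property of the tensor product
  (\<open>tensor_product_universal\<close>), and the step from a split monomorphism to a direct summand is
  \<open>retract_imp_iso_direct_summand\<close>.
\<close>

section \<open>Bimodule homomorphisms and retracts\<close>

definition bimodule_hom ::
  "('r, 'a) ring_scheme \<Rightarrow> ('s, 'b) ring_scheme \<Rightarrow>
   ('r, 's, 'm, 'c) bimodule_scheme \<Rightarrow> ('r, 's, 'n, 'd) bimodule_scheme \<Rightarrow> ('m \<Rightarrow> 'n) set" where
  "bimodule_hom R S M N =
    {h \<in> hom (add_monoid M) (add_monoid N).
        (\<forall>r\<in>carrier R. \<forall>x\<in>carrier M. h (r \<odot>\<^bsub>M\<^esub> x) = r \<odot>\<^bsub>N\<^esub> h x) \<and>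
        (\<forall>s\<in>carrier S. \<forall>x\<in>carrier M. h (x \<triangleleft>\<^bsub>M\<^esub> s) = h x \<triangleleft>\<^bsub>N\<^esub> s)}"

lemma bimodule_homI:
  assumes "\<And>x. x \<in> carrier M \<Longrightarrow> h x \<in> carrier N"
    and "\<And>x y. \<lbrakk>x \<in> carrier M; y \<in> carrier M\<rbrakk> \<Longrightarrow> h (x \<oplus>\<^bsub>M\<^esub> y) = h x \<oplus>\<^bsub>N\<^esub> h y"
    and "\<And>r x. \<lbrakk>r \<in> carrier R; x \<in> carrier M\<rbrakk> \<Longrightarrow> h (r \<odot>\<^bsub>M\<^esub> x) = r \<odot>\<^bsub>N\<^esub> h x"
    and "\<And>s x. \<lbrakk>s \<in> carrier S; x \<in> carrier M\<rbrakk> \<Longrightarrow> h (x \<triangleleft>\<^bsub>M\<^esub> s) = h x \<triangleleft>\<^bsub>N\<^esub> s"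
  shows "h \<in> bimodule_hom R S M N"
  using assms by (auto simp: bimodule_hom_def hom_def)

lemma bimodule_homD:
  assumes "h \<in> bimodule_hom R S M N"
  shows "h \<in> hom (add_monoid M) (add_monoid N)"
    and "x \<in> carrier M \<Longrightarrow> h x \<in> carrier N"
    and "\<lbrakk>x \<in> carrier M; y \<in> carrier M\<rbrakk> \<Longrightarrow> h (x \<oplus>\<^bsub>M\<^esub> y) = h x \<oplus>\<^bsub>N\<^esub> h y"
    and "\<lbrakk>r \<in> carrier R; x \<in> carrier M\<rbrakk> \<Longrightarrow> h (r \<odot>\<^bsub>M\<^esub> x) = r \<odot>\<^bsub>N\<^esub> h x"
    and "\<lbrakk>s \<in> carrier S; x \<in> carrier M\<rbrakk> \<Longrightarrow> h (x \<triangleleft>\<^bsub>M\<^esub> s) = h x \<triangleleft>\<^bsub>N\<^esub> s"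
  using assms by (auto simp: bimodule_hom_def hom_def)

lemma bimodule_hom_group_hom:
  assumes "bimodule R S M" "bimodule R S N" "h \<in> bimodule_hom R S M N"
  shows "group_hom (add_monoid M) (add_monoid N) h"
proof -
  interpret M: bimodule R S M by fact
  interpret N: bimodule R S N by fact
  show ?thesis
    by (intro group_hom.intro group_hom_axioms.intro M.M.a_group N.M.a_group bimodule_homD[OF assms(3)])
qed

lemma bimodule_hom_compose:
  assumes "h \<in> bimodule_hom R S M N" "k \<in> bimodule_hom R S N P"
  shows "k \<circ> h \<in> bimodule_hom R S M P"
  by (rule bimodule_homI) (simp_all add: bimodule_homD[OF assms(1)] bimodule_homD[OF assms(2)])

lemma subbimodule_hom_image:
  assumes "bimodule R S M" "bimodule R S N" "h \<in> bimodule_hom R S M N"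
  shows "subbimodule R S (h ` carrier M) N"
proof -
  interpret M: bimodule R S M by fact
  interpret N: bimodule R S N by fact
  interpret h: group_hom "add_monoid M" "add_monoid N" h by (rule bimodule_hom_group_hom[OF assms])
  have "additive_subgroup (h ` carrier M) N"
    using h.img_is_subgroup by (intro additive_subgroupI) simp
  then show ?thesis
    by (auto simp: subbimodule_def M.smult_closed M.rsmult_closed
        bimodule_homD(4,5)[OF assms(3), symmetric])
qed

lemma subbimodule_hom_kernel:
  assumes "bimodule R S M" "bimodule R S N" "h \<in> bimodule_hom R S M N"
  shows "subbimodule R S {x \<in> carrier M. h x = \<zero>\<^bsub>N\<^esub>} M"
proof -
  interpret M: bimodule R S M by fact
  interpret N: bimodule R S N by fact
  interpret h: group_hom "add_monoid M" "add_monoid N" h by (rule bimodule_hom_group_hom[OF assms])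
  have sub: "additive_subgroup {x \<in> carrier M. h x = \<zero>\<^bsub>N\<^esub>} M"
    using h.subgroup_kernel by (intro additive_subgroupI) (simp add: kernel_def)
  have l: "r \<odot>\<^bsub>N\<^esub> \<zero>\<^bsub>N\<^esub> = \<zero>\<^bsub>N\<^esub>" if "r \<in> carrier R" for r
    using N.smult_r_distr[OF that N.M.zero_closed N.M.zero_closed] N.smult_closed[OF that N.M.zero_closed]
    by (metis N.M.add.l_cancel_one N.M.l_zero N.M.zero_closed)
  have r: "\<zero>\<^bsub>N\<^esub> \<triangleleft>\<^bsub>N\<^esub> s = \<zero>\<^bsub>N\<^esub>" if "s \<in> carrier S" for s
    using N.rsmult_l_distr[OF that N.M.zero_closed N.M.zero_closed] N.rsmult_closed[OF that N.M.zero_closed]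
    by (metis N.M.add.l_cancel_one N.M.l_zero N.M.zero_closed)
  show ?thesis
    using sub by (simp add: subbimodule_def M.smult_closed M.rsmult_closed
        bimodule_homD(4,5)[OF assms(3)] l r)
qed

text \<open>
  The complement of the image of \<open>i\<close> is the kernel of \<open>p\<close>: each \<open>y\<close> splits as
  \<open>i (p y) + (y - i (p y))\<close>.
\<close>

lemma retract_imp_iso_direct_summand:
  assumes M: "bimodule R S M" and N: "bimodule R S N"
    and i: "i \<in> bimodule_hom R S M N" and p: "p \<in> bimodule_hom R S N M"
    and pi: "\<And>x. x \<in> carrier M \<Longrightarrow> p (i x) = x"
  shows "iso_direct_summand R S M N"
proof -
  interpret M: bimodule R S M by fact
  interpret N: bimodule R S N by fact
  interpret i: group_hom "add_monoid M" "add_monoid N" i by (rule bimodule_hom_group_hom[OF M N i])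
  interpret p: group_hom "add_monoid N" "add_monoid M" p by (rule bimodule_hom_group_hom[OF N M p])
  define K where "K = i ` carrier M"
  define L where "L = {y \<in> carrier N. p y = \<zero>\<^bsub>M\<^esub>}"
  have K: "subbimodule R S K N" unfolding K_def by (rule subbimodule_hom_image[OF M N i])
  have L: "subbimodule R S L N" unfolding L_def by (rule subbimodule_hom_kernel[OF N M p])
  have ic: "x \<in> carrier M \<Longrightarrow> i x \<in> carrier N" and pc: "y \<in> carrier N \<Longrightarrow> p y \<in> carrier M" for x y
    using bimodule_homD(2)[OF i] bimodule_homD(2)[OF p] by auto
  have "y \<in> K <+>\<^bsub>N\<^esub> L" if y: "y \<in> carrier N" for y
  proof -
    define z where "z = \<ominus>\<^bsub>N\<^esub> i (p y) \<oplus>\<^bsub>N\<^esub> y"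
    have z: "z \<in> carrier N" using y by (simp add: z_def ic pc)
    have eq: "y = i (p y) \<oplus>\<^bsub>N\<^esub> z"
      using y by (simp add: z_def ic pc N.M.r_neg N.M.a_assoc[symmetric])
    have "p y = p y \<oplus>\<^bsub>M\<^esub> p z"
      using y z bimodule_homD(3)[OF p, of "i (p y)" z] by (simp add: ic pc pi eq[symmetric])
    then have "p z = \<zero>\<^bsub>M\<^esub>" using M.M.add.l_cancel_one'[OF pc[OF y] pc[OF z]] by simp
    then have "z \<in> L" using z by (simp add: L_def)
    with eq y pc show ?thesis unfolding K_def set_add_def' by blast
  qed
  moreover have "K <+>\<^bsub>N\<^esub> L \<subseteq> carrier N"
    unfolding set_add_def' by (auto simp: K_def L_def ic)
  moreover have "K \<inter> L = {\<zero>\<^bsub>N\<^esub>}"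
    using i.hom_one p.hom_one by (force simp: K_def L_def pi)
  ultimately have "direct_summand R S K N"
    using K L unfolding direct_summand_def by blast
  moreover have "bij_betw i (carrier M) K"
    unfolding K_def by (rule inj_on_imp_bij_betw) (metis inj_onI pi)
  then have "i \<in> bimodule_iso R S M (N\<lparr>carrier := K\<rparr>)"
    by (auto simp: bimodule_iso_def bimodule_homD[OF i])
  ultimately show ?thesis unfolding iso_direct_summand_def by blast
qed

lemma bimodule_power_one_inject:
  "(\<lambda>x. \<lambda>j\<in>{..<1}. x) \<in> bimodule_hom R S M (bimodule_power M 1)"
  by (rule bimodule_homI) (auto simp: bimodule_power_def fun_eq_iff)

lemma bimodule_power_one_project:
  "(\<lambda>x. x 0) \<in> bimodule_hom R S (bimodule_power M 1) M"
  by (rule bimodule_homI) (auto simp: bimodule_power_def)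


section \<open>Elementary tensors and the universal property\<close>

definition pure_tensor ::
  "('b, 'a) ring_scheme \<Rightarrow> ('r, 'b, 'm, 'c) bimodule_scheme \<Rightarrow>
   ('b, 's, 'n, 'd) bimodule_scheme \<Rightarrow> 'm \<Rightarrow> 'n \<Rightarrow> (('m \<times> 'n) \<Rightarrow>\<^sub>0 int) set" where
  "pure_tensor B M N x y = tensor_kernel B M N #>\<^bsub>tensor_free M N\<^esub> frag_of (x, y)"

locale tensor_factors = M: bimodule R B M + N: bimodule B S N
  for R (structure) and B (structure) and S (structure)
    and M :: "('r, 'b, 'm, 'c) bimodule_scheme" (structure)
    and N :: "('b, 's, 'n, 'd) bimodule_scheme" (structure)
begin

lemmas factors = M.bimodule_axioms N.bimodule_axioms

abbreviation "F \<equiv> tensor_free M N"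
abbreviation "K \<equiv> tensor_kernel B M N"
abbreviation "T \<equiv> tensor_product B M N"
abbreviation tensor (infixl \<open>\<otimes>\<^sub>t\<close> 70) where "x \<otimes>\<^sub>t y \<equiv> pure_tensor B M N x y"

sublocale F: comm_group F by (rule abelian_free_Abelian_group)

sublocale K: normal K F
  by (rule F.subgroup_imp_normal[OF tensor_kernel_subgroup[OF factors]])

sublocale T: bimodule R S T by (rule tensor_product_bimodule[OF factors])

lemma relator_in_kernel: "t \<in> tensor_relators B M N \<Longrightarrow> t \<in> K"
  unfolding tensor_kernel_def by (rule generate.incl)

lemma add_left_relator:
  assumes "x \<in> carrier M" "x' \<in> carrier M" "y \<in> carrier N"
  shows "frag_of (x \<oplus>\<^bsub>M\<^esub> x', y) - frag_of (x, y) - frag_of (x', y) \<in> K"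
  by (rule relator_in_kernel) (use assms in \<open>auto simp: tensor_relators_def\<close>)

lemma add_right_relator:
  assumes "x \<in> carrier M" "y \<in> carrier N" "y' \<in> carrier N"
  shows "frag_of (x, y \<oplus>\<^bsub>N\<^esub> y') - frag_of (x, y) - frag_of (x, y') \<in> K"
  by (rule relator_in_kernel) (use assms in \<open>auto simp: tensor_relators_def\<close>)

lemma balance_relator:
  assumes "x \<in> carrier M" "b \<in> carrier B" "y \<in> carrier N"
  shows "frag_of (x \<triangleleft>\<^bsub>M\<^esub> b, y) - frag_of (x, b \<odot>\<^bsub>N\<^esub> y) \<in> K"
  by (rule relator_in_kernel) (use assms in \<open>auto simp: tensor_relators_def\<close>)

lemma coset_eqI:
  assumes "u - v \<in> K" "u \<in> carrier F" "v \<in> carrier F"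
  shows "K #>\<^bsub>F\<^esub> u = K #>\<^bsub>F\<^esub> v"
proof -
  have "u = (u - v) \<otimes>\<^bsub>F\<^esub> v" by simp
  then have "u \<in> K #>\<^bsub>F\<^esub> v" using assms(1) unfolding r_coset_def by blast
  then show ?thesis using F.repr_independence[OF _ assms(3) K.subgroup_axioms] by simp
qed

lemma tensor_carrier: "carrier T = (\<lambda>u. K #>\<^bsub>F\<^esub> u) ` carrier F"
  by (simp add: tensor_product_def Let_def carrier_FactGroup)

lemma hom_from_tensor: "hom (add_monoid T) G = hom (F Mod K) G"
  by (simp add: tensor_product_def Let_def hom_def)

lemma coset_hom: "(\<lambda>u. K #>\<^bsub>F\<^esub> u) \<in> hom F (add_monoid T)"
proof -
  have "hom F (add_monoid T) = hom F (F Mod K)"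
    by (simp add: tensor_product_def Let_def hom_def)
  then show ?thesis using K.r_coset_hom_Mod by simp
qed

lemma pure_tensor_closed:
  assumes "x \<in> carrier M" "y \<in> carrier N" shows "x \<otimes>\<^sub>t y \<in> carrier T"
  unfolding tensor_carrier pure_tensor_def using assms by (intro imageI) simp

lemma pure_tensor_add_left:
  assumes "x \<in> carrier M" "x' \<in> carrier M" "y \<in> carrier N"
  shows "(x \<oplus>\<^bsub>M\<^esub> x') \<otimes>\<^sub>t y = (x \<otimes>\<^sub>t y) \<oplus>\<^bsub>T\<^esub> (x' \<otimes>\<^sub>t y)"
proof -
  have c: "frag_of (x, y) \<in> carrier F" "frag_of (x', y) \<in> carrier F" using assms by simp_all
  then have s: "frag_of (x, y) + frag_of (x', y) \<in> carrier F"
    using F.m_closed by (metis mult_free_Abelian_group)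
  have "(x \<oplus>\<^bsub>M\<^esub> x') \<otimes>\<^sub>t y = K #>\<^bsub>F\<^esub> (frag_of (x, y) + frag_of (x', y))"
    unfolding pure_tensor_def
    by (rule coset_eqI[OF _ _ s]) (use assms add_left_relator in \<open>simp_all add: diff_diff_eq\<close>)
  then show ?thesis
    using hom_mult[OF coset_hom c] by (simp add: pure_tensor_def)
qed

lemma pure_tensor_balanced:
  assumes "x \<in> carrier M" "b \<in> carrier B" "y \<in> carrier N"
  shows "(x \<triangleleft>\<^bsub>M\<^esub> b) \<otimes>\<^sub>t y = x \<otimes>\<^sub>t (b \<odot>\<^bsub>N\<^esub> y)"
  unfolding pure_tensor_def
  by (rule coset_eqI[OF balance_relator]) (use assms in \<open>simp_all add: M.rsmult_closed N.smult_closed\<close>)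

text \<open>
  To evaluate the outer actions on elementary tensors, the representative-independence behind
  \<open>tensor_induced_coset\<close> is needed: each action carries the defining relators to relators.
\<close>

lemma smult_pure_tensor:
  assumes "r \<in> carrier R" "x \<in> carrier M" "y \<in> carrier N"
  shows "r \<odot>\<^bsub>T\<^esub> (x \<otimes>\<^sub>t y) = (r \<odot>\<^bsub>M\<^esub> x) \<otimes>\<^sub>t y"
proof -
  define l where "l = (\<lambda>(x, y). (r \<odot>\<^bsub>M\<^esub> x, y :: 'n))"
  have lc: "l \<in> carrier M \<times> carrier N \<rightarrow> carrier M \<times> carrier N"
    using assms(1) by (auto simp: l_def M.smult_closed)
  have st: "frag_extend (frag_of \<circ> l) t \<in> K" if "t \<in> tensor_relators B M N" for t
    using that unfolding tensor_relators_def
    by (safe; simp add: assms(1) frag_extend_diff l_def M.smult_r_distr M.smult_rsmult[symmetric]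
        add_left_relator add_right_relator balance_relator M.smult_closed)
  have "frag_of (x, y) \<in> carrier F" using assms by simp
  from tensor_induced_coset[OF factors lc st this] show ?thesis
    by (simp add: pure_tensor_def tensor_product_def Let_def l_def)
qed

lemma rsmult_pure_tensor:
  assumes "s \<in> carrier S" "x \<in> carrier M" "y \<in> carrier N"
  shows "(x \<otimes>\<^sub>t y) \<triangleleft>\<^bsub>T\<^esub> s = x \<otimes>\<^sub>t (y \<triangleleft>\<^bsub>N\<^esub> s)"
proof -
  define l where "l = (\<lambda>(x :: 'm, y). (x, y \<triangleleft>\<^bsub>N\<^esub> s))"
  have lc: "l \<in> carrier M \<times> carrier N \<rightarrow> carrier M \<times> carrier N"
    using assms(1) by (auto simp: l_def N.rsmult_closed)
  have st: "frag_extend (frag_of \<circ> l) t \<in> K" if "t \<in> tensor_relators B M N" for t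
    using that unfolding tensor_relators_def
    by (safe; simp add: assms(1) frag_extend_diff l_def N.rsmult_l_distr N.smult_rsmult
        add_left_relator add_right_relator balance_relator N.rsmult_closed)
  have "frag_of (x, y) \<in> carrier F" using assms by simp
  from tensor_induced_coset[OF factors lc st this] show ?thesis
    by (simp add: pure_tensor_def tensor_product_def Let_def l_def)
qed

text \<open>
  Elementary tensors are the cosets of the free generators, so they generate the tensor product
  as an abelian group.
\<close>

lemma tensor_hom_ext:
  assumes G: "group G"
    and h: "h \<in> hom (add_monoid T) G" and k: "k \<in> hom (add_monoid T) G"
    and eq: "\<And>x y. \<lbrakk>x \<in> carrier M; y \<in> carrier N\<rbrakk> \<Longrightarrow> h (x \<otimes>\<^sub>t y) = k (x \<otimes>\<^sub>t y)"
    and X: "X \<in> carrier T"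
  shows "h X = k X"
proof -
  let ?c = "\<lambda>u. K #>\<^bsub>F\<^esub> u"
  interpret h: group_hom F G "h \<circ> ?c"
    by (intro group_hom.intro group_hom_axioms.intro F.is_group G Group.hom_compose[OF coset_hom h])
  interpret k: group_hom F G "k \<circ> ?c"
    by (intro group_hom.intro group_hom_axioms.intro F.is_group G Group.hom_compose[OF coset_hom k])
  obtain u where u: "Poly_Mapping.keys u \<subseteq> carrier M \<times> carrier N" "X = ?c u"
    using X by (auto simp: tensor_carrier)
  from u(1) have "(h \<circ> ?c) u = (k \<circ> ?c) u"
  proof (induction u
      rule: free_Abelian_group_induct[consumes 1, case_names zero diff generator])
    case zero
    then show ?case using h.hom_one k.hom_one by simp
  next
    case (diff u v)
    then have v: "- v \<in> carrier F" "inv\<^bsub>F\<^esub> v = - v" "u \<in> carrier F" "v \<in> carrier F" by simp_all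
    have "(h \<circ> ?c) (- v) = (k \<circ> ?c) (- v)"
      using h.hom_inv[OF v(4)] k.hom_inv[OF v(4)] diff v by (simp del: o_apply)
    then show ?case
      using h.hom_mult[OF v(3,1)] k.hom_mult[OF v(3,1)] diff by (simp del: o_apply)
  next
    case (generator z)
    then show ?case using eq by (cases z) (simp add: pure_tensor_def)
  qed
  then show ?thesis by (simp add: u(2))
qed

text \<open>
  The linear extension of a biadditive balanced map to the free abelian group vanishes on the
  relators, hence on the subgroup that they generate, and so factors through the quotient.
\<close>

lemma tensor_product_universal:
  assumes P: "bimodule R S P"
    and closed: "\<And>x y. \<lbrakk>x \<in> carrier M; y \<in> carrier N\<rbrakk> \<Longrightarrow> \<beta> x y \<in> carrier P"
    and add_left: "\<And>x x' y. \<lbrakk>x \<in> carrier M; x' \<in> carrier M; y \<in> carrier N\<rbrakk> \<Longrightarrow>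
      \<beta> (x \<oplus>\<^bsub>M\<^esub> x') y = \<beta> x y \<oplus>\<^bsub>P\<^esub> \<beta> x' y"
    and add_right: "\<And>x y y'. \<lbrakk>x \<in> carrier M; y \<in> carrier N; y' \<in> carrier N\<rbrakk> \<Longrightarrow>
      \<beta> x (y \<oplus>\<^bsub>N\<^esub> y') = \<beta> x y \<oplus>\<^bsub>P\<^esub> \<beta> x y'"
    and balanced: "\<And>x b y. \<lbrakk>x \<in> carrier M; b \<in> carrier B; y \<in> carrier N\<rbrakk> \<Longrightarrow>
      \<beta> (x \<triangleleft>\<^bsub>M\<^esub> b) y = \<beta> x (b \<odot>\<^bsub>N\<^esub> y)"
    and smult: "\<And>r x y. \<lbrakk>r \<in> carrier R; x \<in> carrier M; y \<in> carrier N\<rbrakk> \<Longrightarrow>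
      \<beta> (r \<odot>\<^bsub>M\<^esub> x) y = r \<odot>\<^bsub>P\<^esub> \<beta> x y"
    and rsmult: "\<And>s x y. \<lbrakk>s \<in> carrier S; x \<in> carrier M; y \<in> carrier N\<rbrakk> \<Longrightarrow>
      \<beta> x (y \<triangleleft>\<^bsub>N\<^esub> s) = \<beta> x y \<triangleleft>\<^bsub>P\<^esub> s"
  shows "\<exists>h\<in>bimodule_hom R S T P. \<forall>x\<in>carrier M. \<forall>y\<in>carrier N. h (x \<otimes>\<^sub>t y) = \<beta> x y"
proof -
  interpret P: bimodule R S P by fact
  have "(\<lambda>(x, y). \<beta> x y) ` (carrier M \<times> carrier N) \<subseteq> carrier (add_monoid P)"
    using closed by auto
  from P.M.a_comm_group[THEN comm_group.free_Abelian_group_universal, OF this]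
  obtain k where k: "k \<in> hom F (add_monoid P)"
    and k_of: "\<And>z. z \<in> carrier M \<times> carrier N \<Longrightarrow> k (frag_of z) = (\<lambda>(x, y). \<beta> x y) z" by metis
  interpret k: group_hom F "add_monoid P" k
    by (intro group_hom.intro group_hom_axioms.intro F.is_group P.M.a_group k)
  have k_diff: "k (u - v) = k u \<ominus>\<^bsub>P\<^esub> k v" if "u \<in> carrier F" "v \<in> carrier F" for u v
  proof -
    have v: "- v \<in> carrier F" "inv\<^bsub>F\<^esub> v = - v" using that by simp_all
    have "k (u + - v) = k u \<oplus>\<^bsub>P\<^esub> k (- v)" using k.hom_mult[OF that(1) v(1)] by simp
    also have "k (- v) = \<ominus>\<^bsub>P\<^esub> k v" using k.hom_inv[OF that(2)] v by (simp add: a_inv_def)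
    finally show ?thesis by (simp add: a_minus_def)
  qed
  have F_diff: "u - v \<in> carrier F" if "u \<in> carrier F" "v \<in> carrier F" for u v
  proof -
    have "u - v = u \<otimes>\<^bsub>F\<^esub> inv\<^bsub>F\<^esub> v" using that by simp
    then show ?thesis using that F.m_closed F.inv_closed by metis
  qed
  have cancel: "(a \<oplus>\<^bsub>P\<^esub> b) \<ominus>\<^bsub>P\<^esub> a \<ominus>\<^bsub>P\<^esub> b = \<zero>\<^bsub>P\<^esub>" if "a \<in> carrier P" "b \<in> carrier P" for a b
    using that P.M.r_neg[of "a \<oplus>\<^bsub>P\<^esub> b"] by (simp add: a_minus_def P.M.minus_add P.M.a_assoc)
  have "k t = \<zero>\<^bsub>P\<^esub>" if "t \<in> tensor_relators B M N" for t
    using that unfolding tensor_relators_def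
    by (elim UnE CollectE exE conjE)
      (simp_all add: k_diff k_of F_diff closed add_left add_right balanced cancel
        M.rsmult_closed N.smult_closed P.M.r_neg a_minus_def[of P "\<beta> _ _" "\<beta> _ _"]
        del: carrier_free_Abelian_group_iff)
  then have "tensor_relators B M N \<subseteq> kernel F (add_monoid P) k"
    using tensor_relators_carrier[OF factors] by (force simp only: kernel_def monoid_record_simps)
  then have "K \<subseteq> kernel F (add_monoid P) k"
    unfolding tensor_kernel_def by (rule F.generate_subgroup_incl[OF _ k.subgroup_kernel])
  from k.FactGroup_universal_kernel[OF K.normal_axioms this]
  obtain h where h: "h \<in> hom (F Mod K) (add_monoid P)"
    and h_of: "\<And>u. u \<in> carrier F \<Longrightarrow> h (K #>\<^bsub>F\<^esub> u) = k u" by metis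
  have h: "h \<in> hom (add_monoid T) (add_monoid P)" using h by (simp add: hom_from_tensor)
  have h_pure: "h (x \<otimes>\<^sub>t y) = \<beta> x y" if "x \<in> carrier M" "y \<in> carrier N" for x y
    using that by (simp add: pure_tensor_def h_of k_of)
  \<comment> \<open>Both composites of an outer action with \<open>h\<close> are additive, so elementary tensors suffice.\<close>
  have "h (r \<odot>\<^bsub>T\<^esub> X) = r \<odot>\<^bsub>P\<^esub> h X" if r: "r \<in> carrier R" and X: "X \<in> carrier T" for r X
  proof (rule tensor_hom_ext[OF P.M.a_group _ _ _ X])
    show "(\<lambda>X. h (r \<odot>\<^bsub>T\<^esub> X)) \<in> hom (add_monoid T) (add_monoid P)"
      "(\<lambda>X. r \<odot>\<^bsub>P\<^esub> h X) \<in> hom (add_monoid T) (add_monoid P)"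
      using h r by (auto simp: hom_def Pi_iff T.smult_closed T.smult_r_distr
          P.smult_closed P.smult_r_distr)
  qed (simp add: r smult_pure_tensor h_pure M.smult_closed smult)
  moreover have "h (X \<triangleleft>\<^bsub>T\<^esub> s) = h X \<triangleleft>\<^bsub>P\<^esub> s" if s: "s \<in> carrier S" and X: "X \<in> carrier T" for s X
  proof (rule tensor_hom_ext[OF P.M.a_group _ _ _ X])
    show "(\<lambda>X. h (X \<triangleleft>\<^bsub>T\<^esub> s)) \<in> hom (add_monoid T) (add_monoid P)"
      "(\<lambda>X. h X \<triangleleft>\<^bsub>P\<^esub> s) \<in> hom (add_monoid T) (add_monoid P)"
      using h s by (auto simp: hom_def Pi_iff T.rsmult_closed T.rsmult_l_distr
          P.rsmult_closed P.rsmult_l_distr)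
  qed (simp add: s rsmult_pure_tensor h_pure N.rsmult_closed rsmult)
  ultimately have "h \<in> bimodule_hom R S T P" using h by (simp add: bimodule_hom_def)
  with h_pure show ?thesis by blast
qed

end


section \<open>The regular bimodule as a retract of the tensor square\<close>

text \<open>
  The witnesses are \<open>a \<mapsto> a \<otimes> 1\<close> and multiplication.  Right \<open>C\<close>-linearity of the first is where
  the factorization of \<open>C \<rightarrow> A\<close> through \<open>B\<close> enters: \<open>c\<close> crosses the tensor sign as the element
  \<open>f c\<close> of \<open>B\<close>.
\<close>

lemma tower_regular_retract_of_tower_tensor:
  fixes A :: "('a, 'k) ring_scheme" and B :: "('b, 'l) ring_scheme" and C :: "('c, 'm) ring_scheme"
  assumes "ring A" and "ring B" and "ring C"
    and f: "f \<in> ring_hom C B" and g: "g \<in> ring_hom B A"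
  obtains i p where "i \<in> bimodule_hom A C (tower_regular A f g) (tower_tensor A B f g)"
    and "p \<in> bimodule_hom A C (tower_tensor A B f g) (tower_regular A f g)"
    and "\<And>x. x \<in> carrier (tower_regular A f g) \<Longrightarrow> p (i x) = x"
proof -
  interpret A: ring A by fact
  let ?M = "induced_bimodule A id g" and ?N = "induced_bimodule A g (g \<circ> f)"
  let ?P = "tower_regular A f g" and ?t = "pure_tensor B ?M ?N"
  have gf: "g \<circ> f \<in> ring_hom C A" by (rule ring_hom_trans[OF f g])
  have ida: "id \<in> ring_hom A A" by (rule id_ring_hom)
  have M: "bimodule A B ?M" by (rule induced_bimodule_bimodule[OF assms(1,1,2) ida g])
  have N: "bimodule B C ?N" by (rule induced_bimodule_bimodule[OF assms(1,2,3) g gf])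
  have P: "bimodule A C ?P"
    unfolding tower_regular_def by (rule induced_bimodule_bimodule[OF assms(1,1,3) ida gf])
  interpret tensor_factors A B C ?M ?N by (intro tensor_factors.intro M N)
  note fc = ring_hom_closed[OF f] and gc = ring_hom_closed[OF g]
  note defs = tower_regular_def induced_bimodule_def
  have "\<exists>p\<in>bimodule_hom A C T ?P. \<forall>x\<in>carrier ?M. \<forall>y\<in>carrier ?N. p (?t x y) = x \<otimes>\<^bsub>A\<^esub> y"
    by (rule tensor_product_universal[OF P])
      (simp_all add: defs A.l_distr A.r_distr A.m_assoc fc gc)
  then obtain p where p: "p \<in> bimodule_hom A C T ?P"
    and p_pure: "\<And>x y. \<lbrakk>x \<in> carrier ?M; y \<in> carrier ?N\<rbrakk> \<Longrightarrow> p (?t x y) = x \<otimes>\<^bsub>A\<^esub> y" by blast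
  have one: "\<one>\<^bsub>A\<^esub> \<in> carrier ?N" by (simp add: defs)
  have balance: "?t (x \<otimes>\<^bsub>A\<^esub> g (f c)) \<one>\<^bsub>A\<^esub> = ?t x \<one>\<^bsub>A\<^esub> \<triangleleft>\<^bsub>T\<^esub> c"
    if "x \<in> carrier A" "c \<in> carrier C" for x c
  proof -
    have "?t (x \<otimes>\<^bsub>A\<^esub> g (f c)) \<one>\<^bsub>A\<^esub> = ?t x (g (f c) \<otimes>\<^bsub>A\<^esub> \<one>\<^bsub>A\<^esub>)"
      using pure_tensor_balanced[of x "f c" "\<one>\<^bsub>A\<^esub>"] that by (simp add: defs fc)
    also have "\<dots> = ?t x (\<one>\<^bsub>A\<^esub> \<otimes>\<^bsub>A\<^esub> g (f c))" using that by (simp add: fc gc)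
    also have "\<dots> = ?t x \<one>\<^bsub>A\<^esub> \<triangleleft>\<^bsub>T\<^esub> c"
      using rsmult_pure_tensor[of c x "\<one>\<^bsub>A\<^esub>"] that by (simp add: defs)
    finally show ?thesis .
  qed
  have i: "(\<lambda>x. ?t x \<one>\<^bsub>A\<^esub>) \<in> bimodule_hom A C ?P T"
  proof (rule bimodule_homI)
    fix x y assume "x \<in> carrier ?P" "y \<in> carrier ?P"
    then show "?t (x \<oplus>\<^bsub>?P\<^esub> y) \<one>\<^bsub>A\<^esub> = ?t x \<one>\<^bsub>A\<^esub> \<oplus>\<^bsub>T\<^esub> ?t y \<one>\<^bsub>A\<^esub>"
      using pure_tensor_add_left[of x y, OF _ _ one] by (simp add: defs)
  next
    fix r x assume "r \<in> carrier A" "x \<in> carrier ?P"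
    then show "?t (r \<odot>\<^bsub>?P\<^esub> x) \<one>\<^bsub>A\<^esub> = r \<odot>\<^bsub>T\<^esub> ?t x \<one>\<^bsub>A\<^esub>"
      using smult_pure_tensor[of r x, OF _ _ one] by (simp add: defs)
  next
    fix x assume "x \<in> carrier ?P"
    then show "?t x \<one>\<^bsub>A\<^esub> \<in> carrier T"
      using pure_tensor_closed[of x, OF _ one] by (simp add: defs)
  next
    fix c x assume "c \<in> carrier C" "x \<in> carrier ?P"
    then show "?t (x \<triangleleft>\<^bsub>?P\<^esub> c) \<one>\<^bsub>A\<^esub> = ?t x \<one>\<^bsub>A\<^esub> \<triangleleft>\<^bsub>T\<^esub> c"
      using balance[of x c] by (simp add: defs)
  qed
  have "p (?t x \<one>\<^bsub>A\<^esub>) = x" if "x \<in> carrier ?P" for x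
    using that p_pure[of x, OF _ one] by (simp add: defs)
  then show thesis using that i p unfolding tower_tensor_def by blast
qed

theorem lemma2p2:
  fixes A :: "('a, 'k) ring_scheme" and B :: "('b, 'l) ring_scheme" and C :: "('c, 'm) ring_scheme"
    and f :: "'c \<Rightarrow> 'b" and g :: "'b \<Rightarrow> 'a"
  assumes "ring A" and "ring B" and "ring C"
    and "f \<in> ring_hom C B" and "g \<in> ring_hom B A"
  shows "right_depth_three A B C f g \<longleftrightarrow>
    H_equivalent A C (tower_tensor A B f g) (tower_regular A f g)"
proof -
  let ?P = "tower_regular A f g" and ?T = "tower_tensor A B f g"
  have gf: "g \<circ> f \<in> ring_hom C A" by (rule ring_hom_trans[OF assms(4,5)])
  have P: "bimodule A C ?P"
    unfolding tower_regular_def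
    by (rule induced_bimodule_bimodule[OF assms(1,1,3) id_ring_hom gf])
  have T: "bimodule A C ?T"
    unfolding tower_tensor_def
    by (rule tensor_product_bimodule[OF induced_bimodule_bimodule[OF assms(1,1,2) id_ring_hom assms(5)]
          induced_bimodule_bimodule[OF assms(1,2,3,5) gf]])
  obtain i p where i: "i \<in> bimodule_hom A C ?P ?T" and p: "p \<in> bimodule_hom A C ?T ?P"
    and pi: "\<And>x. x \<in> carrier ?P \<Longrightarrow> p (i x) = x"
    using tower_regular_retract_of_tower_tensor[OF assms] by blast
  have "iso_direct_summand A C ?P (bimodule_power ?T 1)"
    by (rule retract_imp_iso_direct_summand[OF P bimodule_power_bimodule[OF T]
          bimodule_hom_compose[OF i bimodule_power_one_inject]
          bimodule_hom_compose[OF bimodule_power_one_project p]])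
      (simp add: pi)
  then have "\<exists>m>0. iso_direct_summand A C ?P (bimodule_power ?T m)"
    using zero_less_one by blast
  then show ?thesis unfolding right_depth_three_def H_equivalent_def by blast
qed

end
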